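(* Let $\pi\in\Delta(K)$ be an invariant distribution of $M$ (i.e. $\pi M=\pi$). Then the sequence $\{v_n(\pi): n\ge 1\}$ is non-decreasing and converges to a scalar $v_\infty(\pi)\in[0,1]$ such that for every $n\ge 1$, $$0\le v_\infty(\pi)-v_n(\pi)\le \left(1-\frac1k\right)^{n-1}.$$
   Context: Setting: $K=\{1,\dots,k\}$ is a finite set, $\Delta(K)$ is the set of probability distributions on $K$ (viewed as $k$-dimensional row vectors; $q(i)$ is the mass of $i$ under $q$), $M$ is a $k\times k$ stochastic matrix, and $u:K\times K\to[0,1]$ is a utility function. For a prior $q\in\Delta(K)$, $\{X_j\}_{j\ge1}$ is the Markov chain on $K$ with $X_1\sim q$ and transition matrix $M$. At each stage $j=1,2,\dots$ a decision maker selects an action $\xi_j\in K$ and then observes only the binary signal $I(\xi_j)=\mathbf 1\{X_j=\xi_j\}$. A policy $\xi=(\xi_j)_{j\ge1}$ specifies each action $\xi_j$ as a (deterministic) function of the past actions $\xi_1,\dots,\xi_{j-1}$ and past signals $I(\xi_1),\dots,I(\xi_{j-1})$ (so $\xi_1$ is a fixed element of $K$). Let $\Xi$ be the set of all policies, and let $P_{q,\xi}$, $E_{q,\xi}$ denote the induced probability and expectation. The value of the $n$-stage problem is $$v_n(q)=\max_{\xi\in\Xi}E_{q,\xi}[u(X_n,\xi_n)].$$ The chain is called stationary when its prior is an invariant distribution $\pi$ of $M$. Convention: $0^0=1$. *)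

theory Defs
  imports "HOL-Probability.Probability"
begin

text \<open>
  The state (and action) space is a finite type \<open>'k\<close> with \<open>k = CARD('k)\<close>. Row vectors are elements
  of \<open>real ^ 'k\<close>; in a matrix \<open>M :: real ^ 'k ^ 'k\<close> the row of state \<open>i\<close> is \<open>M $ i\<close>, so that
  \<open>M $ i $ j\<close> is the probability of a transition from \<open>i\<close> to \<open>j\<close>.
\<close>

definition prob_vectors :: "(real ^ 'k::finite) set" where
  "prob_vectors = {q. (\<forall>i. 0 \<le> q $ i) \<and> (\<Sum>i\<in>UNIV. q $ i) = 1}"

definition stochastic_matrix :: "real ^ 'k::finite ^ 'k \<Rightarrow> bool" where
  "stochastic_matrix M \<longleftrightarrow> (\<forall>i. M $ i \<in> prob_vectors)"

definition pmf_of_vec :: "real ^ 'k::finite \<Rightarrow> 'k pmf" where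
  "pmf_of_vec q = embed_pmf (\<lambda>i. q $ i)"


subsection \<open>The Markov chain\<close>

text \<open>Conditional law of coordinate \<open>i\<close> of a path given the earlier coordinates.\<close>

definition chain_kernel ::
  "real ^ 'k::finite \<Rightarrow> real ^ 'k ^ 'k \<Rightarrow> nat \<Rightarrow> (nat \<Rightarrow> 'k) \<Rightarrow> 'k measure" where
  "chain_kernel q M i \<omega> =
    measure_pmf (if i = 0 then pmf_of_vec q else pmf_of_vec (M $ \<omega> (i - 1)))"

text \<open>
  The law of the chain on the space of infinite paths, obtained from the Ionescu--Tulcea theorem.
  Lemma \<open>chain_law\<close> below gives its finite-dimensional distributions.
\<close>

definition chain_measure ::
  "real ^ 'k::finite \<Rightarrow> real ^ 'k ^ 'k \<Rightarrow> (nat \<Rightarrow> 'k) measure" where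
  "chain_measure q M =
    projective_family.lim UNIV (Ionescu_Tulcea.CI (chain_kernel q M) (\<lambda>_. count_space UNIV))
      (\<lambda>_. count_space UNIV)"

text \<open>Stages are numbered from 1, path coordinates from 0; only \<open>state_at j\<close> with \<open>j \<ge> 1\<close> is meaningful.\<close>

definition state_at :: "nat \<Rightarrow> (nat \<Rightarrow> 'k) \<Rightarrow> 'k" where
  "state_at j \<omega> = \<omega> (j - 1)"


subsection \<open>Policies and values\<close>

text \<open>
  A policy maps the list of past pairs (action, signal), oldest first, to the next action; the
  length of the list determines the stage. The signal at stage \<open>j\<close> is the truth
  value of \<open>state_at j \<omega> = act \<xi> j \<omega>\<close>.
\<close>

type_synonym 'k policy = "('k \<times> bool) list \<Rightarrow> 'k"

primrec history :: "'k policy \<Rightarrow> (nat \<Rightarrow> 'k) \<Rightarrow> nat \<Rightarrow> ('k \<times> bool) list" where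
  "history \<xi> \<omega> 0 = []"
| "history \<xi> \<omega> (Suc j) =
    (let h = history \<xi> \<omega> j; a = \<xi> h in h @ [(a, state_at (Suc j) \<omega> = a)])"

definition act :: "'k policy \<Rightarrow> nat \<Rightarrow> (nat \<Rightarrow> 'k) \<Rightarrow> 'k" where
  "act \<xi> j \<omega> = \<xi> (history \<xi> \<omega> (j - 1))"

definition expected_utility ::
  "real ^ 'k::finite ^ 'k \<Rightarrow> ('k \<Rightarrow> 'k \<Rightarrow> real) \<Rightarrow> nat \<Rightarrow> real ^ 'k \<Rightarrow> 'k policy \<Rightarrow> real" where
  "expected_utility M u n q \<xi> = (\<integral>\<omega>. u (state_at n \<omega>) (act \<xi> n \<omega>) \<partial>chain_measure q M)"

text \<open>The maximum is over a finite set of reals, see \<open>finite_range_expected_utility\<close> below.\<close>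

definition stage_value ::
  "real ^ 'k::finite ^ 'k \<Rightarrow> ('k \<Rightarrow> 'k \<Rightarrow> real) \<Rightarrow> nat \<Rightarrow> real ^ 'k \<Rightarrow> real" where
  "stage_value M u n q = Max (range (\<lambda>\<xi>. expected_utility M u n q \<xi>))"


subsection \<open>Basic facts justifying the definitions\<close>

lemma pmf_of_vec:
  assumes "q \<in> prob_vectors"
  shows "pmf (pmf_of_vec q) i = q $ i"
  unfolding pmf_of_vec_def
proof (rule pmf_embed_pmf)
  show "0 \<le> q $ x" for x
    using assms by (simp add: prob_vectors_def)
  show "(\<integral>\<^sup>+ x. ennreal (q $ x) \<partial>count_space UNIV) = 1"
    using assms by (simp add: nn_integral_count_space_finite prob_vectors_def sum_ennreal)
qed

lemma Ionescu_Tulcea_chain: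
  "Ionescu_Tulcea (chain_kernel q M) (\<lambda>_. count_space (UNIV :: 'k::finite set))"
proof (rule Ionescu_Tulcea.intro)
  fix i
  show "chain_kernel q M i \<in>
    Pi\<^sub>M {0..<i} (\<lambda>_. count_space UNIV) \<rightarrow>\<^sub>M subprob_algebra (count_space (UNIV :: 'k set))"
  proof (cases i)
    case 0
    then show ?thesis
      by (simp add: chain_kernel_def[abs_def] measure_pmf_in_subprob_algebra)
  next
    case (Suc j)
    have "(\<lambda>\<omega>. \<omega> j) \<in> Pi\<^sub>M {0..<Suc j} (\<lambda>_. count_space (UNIV :: 'k set)) \<rightarrow>\<^sub>M count_space UNIV"
      by (rule measurable_component_singleton) simp
    moreover have "(\<lambda>x. measure_pmf (pmf_of_vec (M $ x)))
        \<in> count_space UNIV \<rightarrow>\<^sub>M subprob_algebra (count_space (UNIV :: 'k set))"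
      by (simp add: measure_pmf_in_subprob_algebra)
    ultimately have "(\<lambda>\<omega>. measure_pmf (pmf_of_vec (M $ \<omega> j))) \<in>
        Pi\<^sub>M {0..<Suc j} (\<lambda>_. count_space UNIV) \<rightarrow>\<^sub>M subprob_algebra (count_space (UNIV :: 'k set))"
      by (rule measurable_compose)
    with Suc show ?thesis
      by (simp add: chain_kernel_def[abs_def])
  qed
  show "prob_space (chain_kernel q M i x)" for x
    unfolding chain_kernel_def by (rule prob_space_measure_pmf)
qed

lemma
  fixes q :: "real ^ 'k::finite"
  shows sets_chain_measure: "sets (chain_measure q M) = sets (Pi\<^sub>M UNIV (\<lambda>_. count_space UNIV))" (is ?S)
    and prob_space_chain_measure: "prob_space (chain_measure q M)" (is ?P)
proof -
  interpret IT: Ionescu_Tulcea "chain_kernel q M" "\<lambda>_. count_space (UNIV :: 'k set)"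
    by (rule Ionescu_Tulcea_chain)
  show ?S
    unfolding chain_measure_def by simp
  have "emeasure IT.PF.lim (space IT.PF.lim) = emeasure IT.PF.lim (IT.PF.emb UNIV {} {\<lambda>_. undefined})"
    by (intro arg_cong[where f = "emeasure IT.PF.lim"]) (auto simp: prod_emb_def space_PiM)
  also have "\<dots> = emeasure (IT.CI {}) {\<lambda>_. undefined}"
    by (intro IT.lim) (auto simp: PiM_empty)
  also have "\<dots> = 1"
    using prob_space.emeasure_space_1[OF IT.PF.prob_space_P[of "{}"]]
    by (simp add: IT.CI_def space_PiM)
  finally show ?P
    unfolding chain_measure_def by (rule prob_spaceI)
qed

lemma chain_law_kernel:
  fixes q :: "real ^ 'k::finite"
  shows "emeasure (chain_measure q M) {\<omega>. \<forall>i<n. \<omega> i = x i} = (\<Prod>i<n. emeasure (chain_kernel q M i x) {x i})"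
proof -
  interpret IT: Ionescu_Tulcea "chain_kernel q M" "\<lambda>_. count_space (UNIV :: 'k set)"
    by (rule Ionescu_Tulcea_chain)
  let ?S = "\<lambda>n. Pi\<^sub>M {0..<n} (\<lambda>_. count_space (UNIV :: 'k set))"
  let ?r = "\<lambda>n. restrict x {0..<n}"
  have sets_r: "{?r n} \<in> sets (?S n)" for n
  proof -
    have "{?r n} = (\<Pi>\<^sub>E i\<in>{0..<n}. {x i})"
      by (auto simp: PiE_singleton[symmetric] PiE_iff extensional_def restrict_def fun_eq_iff)
    then show ?thesis
      by (simp add: sets_PiM_I_finite)
  qed
  have C: "emeasure (IT.C 0 n (\<lambda>_. undefined)) {?r n} = (\<Prod>i<n. emeasure (chain_kernel q M i x) {x i})"
    for n
  proof (induction n)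
    case 0
    have "?r 0 = (\<lambda>_. undefined)" by auto
    with sets_r[of 0] show ?case by (simp add: space_PiM)
  next
    case (Suc n)
    have sp: "space (IT.C 0 n (\<lambda>_. undefined)) = space (?S n)"
      using IT.space_C[of "\<lambda>_. undefined" 0 n] by (simp add: space_PiM)
    have meas: "IT.eP n \<in> measurable (IT.C 0 n (\<lambda>_. undefined)) (subprob_algebra (?S (Suc n)))"
      using IT.measurable_eP[of n] IT.sets_C[of "\<lambda>_. undefined" 0 n]
      by (simp add: space_PiM cong: measurable_cong_sets)
    have "emeasure (IT.C 0 (Suc n) (\<lambda>_. undefined)) {?r (Suc n)}
        = (\<integral>\<^sup>+\<omega>. emeasure (IT.eP n \<omega>) {?r (Suc n)} \<partial>IT.C 0 n (\<lambda>_. undefined))"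
      using meas sp sets_r[of "Suc n"]
      by (simp add: emeasure_bind[where N = "?S (Suc n)"])
    also have "\<dots> = (\<integral>\<^sup>+\<omega>. emeasure (chain_kernel q M n x) {x n} * indicator {?r n} \<omega>
        \<partial>IT.C 0 n (\<lambda>_. undefined))"
    proof (rule nn_integral_cong)
      fix \<omega> assume "\<omega> \<in> space (IT.C 0 n (\<lambda>_. undefined))"
      with sp have \<omega>: "\<omega> \<in> space (?S n)" by simp
      then have \<omega>_ext: "\<omega> \<in> extensional {0..<n}" by (simp add: space_PiM PiE_iff)
      have "(\<lambda>y. fun_upd \<omega> n y) -` {?r (Suc n)} = (if \<omega> = ?r n then {x n} else {})"
      proof (cases "\<omega> = ?r n")
        case True
        then show ?thesis by (auto simp: fun_eq_iff less_Suc_eq split: if_splits)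
      next
        case False
        then obtain i where i: "\<omega> i \<noteq> ?r n i" by (meson ext)
        with \<omega>_ext have "i < n" by (auto simp: extensional_def split: if_splits)
        with i have "fun_upd \<omega> n y \<noteq> ?r (Suc n)" for y
          by (auto simp: fun_eq_iff intro!: exI[of _ i])
        with False show ?thesis by auto
      qed
      moreover have "chain_kernel q M n (?r n) = chain_kernel q M n x"
        by (simp add: chain_kernel_def)
      ultimately show "emeasure (IT.eP n \<omega>) {?r (Suc n)}
          = emeasure (chain_kernel q M n x) {x n} * indicator {?r n} \<omega>"
        using IT.emeasure_eP[OF \<omega> sets_r[of "Suc n"]] by simp
    qed
    also have "\<dots> = emeasure (chain_kernel q M n x) {x n} * emeasure (IT.C 0 n (\<lambda>_. undefined)) {?r n}"
      using sets_r[of n] IT.sets_C[of "\<lambda>_. undefined" 0 n]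
      by (subst nn_integral_cmult_indicator) (simp_all add: space_PiM)
    finally show ?case
      by (simp only: Suc.IH prod.lessThan_Suc mult.commute)
  qed
  have "{\<omega>. \<forall>i<n. \<omega> i = x i} = IT.PF.emb UNIV {0..<n} {?r n}"
    by (auto simp: prod_emb_def space_PiM fun_eq_iff restrict_def split: if_splits)
  then have "emeasure (chain_measure q M) {\<omega>. \<forall>i<n. \<omega> i = x i} = emeasure (IT.CI {0..<n}) {?r n}"
    unfolding chain_measure_def using IT.lim[OF _ sets_r[of n]] by simp
  also have "\<dots> = emeasure (IT.C 0 n (\<lambda>_. undefined)) (IT.PF.emb {0..<n} {0..<n} {?r n})"
    by (rule IT.emeasure_CI[OF subset_refl sets_r])
  also have "IT.PF.emb {0..<n} {0..<n} {?r n} = {?r n}"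
    by (rule prod_emb_id) auto
  finally show ?thesis
    by (simp add: C)
qed

lemma chain_law:
  fixes q :: "real ^ 'k::finite"
  assumes q: "q \<in> prob_vectors" and M: "stochastic_matrix M"
  shows "measure (chain_measure q M) {\<omega>. \<forall>j\<in>{1..Suc n}. state_at j \<omega> = x j} =
    q $ x 1 * (\<Prod>j=1..n. M $ x j $ x (Suc j))"
proof -
  let ?y = "\<lambda>i. x (Suc i)"
  have row: "M $ i \<in> prob_vectors" for i
    using M by (simp add: stochastic_matrix_def)
  have "{\<omega>. \<forall>j\<in>{1..Suc n}. state_at j \<omega> = x j} = {\<omega>. \<forall>i<Suc n. \<omega> i = ?y i}"
  proof (intro Collect_cong iffI allI impI ballI)
    fix \<omega> i assume "\<forall>j\<in>{1..Suc n}. state_at j \<omega> = x j" "i < Suc n"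
    from bspec[OF this(1), of "Suc i"] this(2) show "\<omega> i = ?y i" by (simp add: state_at_def)
  next
    fix \<omega> j assume "\<forall>i<Suc n. \<omega> i = ?y i" "j \<in> {1..Suc n}"
    from spec[OF this(1), of "j - 1"] this(2) show "state_at j \<omega> = x j" by (auto simp: state_at_def)
  qed
  then have "emeasure (chain_measure q M) {\<omega>. \<forall>j\<in>{1..Suc n}. state_at j \<omega> = x j} =
      (\<Prod>i<Suc n. emeasure (chain_kernel q M i ?y) {?y i})"
    by (simp only: chain_law_kernel)
  also have "\<dots> = ennreal (q $ x 1) * (\<Prod>i<n. ennreal (M $ x (Suc i) $ x (Suc (Suc i))))"
    by (simp add: prod.lessThan_Suc_shift chain_kernel_def emeasure_pmf_single pmf_of_vec[OF q]
        pmf_of_vec[OF row] del: prod.lessThan_Suc)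
  also have "(\<Prod>i<n. ennreal (M $ x (Suc i) $ x (Suc (Suc i)))) =
      ennreal (\<Prod>i<n. M $ x (Suc i) $ x (Suc (Suc i)))"
    using row by (intro prod_ennreal) (simp add: prob_vectors_def)
  also have "(\<Prod>i<n. M $ x (Suc i) $ x (Suc (Suc i))) = (\<Prod>j=1..n. M $ x j $ x (Suc j))"
    using prod.atLeast_Suc_atMost_Suc_shift[of "\<lambda>j. M $ x j $ x (Suc j)" 0 "n - 1"]
    by (cases n) (simp_all add: atLeast0AtMost lessThan_Suc_atMost)
  also have "ennreal (q $ x 1) * ennreal (\<Prod>j=1..n. M $ x j $ x (Suc j)) =
      ennreal (q $ x 1 * (\<Prod>j=1..n. M $ x j $ x (Suc j)))"
    using q row by (intro ennreal_mult[symmetric]) (auto simp: prob_vectors_def intro!: prod_nonneg)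
  finally show ?thesis
    using q row
    by (simp add: measure_def prob_vectors_def prod_nonneg)
qed

lemma length_history: "length (history \<xi> \<omega> j) = j"
  by (induction j) (simp_all add: Let_def)

lemma history_restrict:
  assumes "j \<le> n"
  shows "history (restrict \<xi> {h. length h < n}) \<omega> j = history \<xi> \<omega> j"
  using assms by (induction j) (simp_all add: Let_def length_history)

lemma finite_range_expected_utility:
  "finite (range (\<lambda>\<xi>. expected_utility M u n q \<xi>))"
proof -
  let ?H = "{h :: ('a \<times> bool) list. length h < Suc n}"
  have "act \<xi> n \<omega> = act (restrict \<xi> ?H) n \<omega>" for \<xi> \<omega>
    using history_restrict[of "n - 1" "Suc n" \<xi> \<omega>] by (auto simp: act_def length_history)
  then have "expected_utility M u n q \<xi> = expected_utility M u n q (restrict \<xi> ?H)" for \<xi>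
    unfolding expected_utility_def by presburger
  then have "range (\<lambda>\<xi>. expected_utility M u n q \<xi>) \<subseteq> expected_utility M u n q ` (?H \<rightarrow>\<^sub>E UNIV)"
    by (metis (no_types, lifting) image_eqI image_subsetI restrict_PiE_iff UNIV_I)
  moreover have "finite ?H"
    using finite_lists_length_le[of "UNIV :: ('a \<times> bool) set" n] by (simp add: less_Suc_eq_le)
  then have "finite (?H \<rightarrow>\<^sub>E (UNIV :: 'a set))"
    by (intro finite_PiE) auto
  ultimately show ?thesis
    by (meson finite_imageI finite_subset)
qed

end

theory Submission
  imports Defs
begin

text \<open>
  Compare \<open>v\<^sub>n\<close> with the payoff of a decision maker who is told the initial state. The latter is an
  upper bound for every \<open>v\<^sub>m\<close> with \<open>m \<ge> n\<close>: in the longer problem one may reveal the state at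
  stage \<open>m - n + 1\<close>, whose law is again \<open>\<pi>\<close>. The uninformed decision maker guesses a most likely
  state until the first success, which occurs at each stage with conditional probability at least
  \<open>1/k\<close>. After a success the state is known, the past becomes irrelevant by the Markov property, and
  continuing optimally is as good as having had all the information. Hence the informed player gains
  at most the probability \<open>(1 - 1/k)^(n - 1)\<close> that \<open>n - 1\<close> guesses fail.
\<close>

text \<open>Histories list the oldest pair first, so fixing their head gives the policy that remains
  after one stage; this drives the recursion of \<open>payoff\<close>.\<close>

definition continuation :: "'k policy \<Rightarrow> 'k \<times> bool \<Rightarrow> 'k policy" where
  "continuation \<xi> e = (\<lambda>h. \<xi> (e # h))"

text \<open>Expected utility after \<open>n\<close> further transitions, that is at stage \<open>n + 1\<close>, from a known initial state.\<close>

primrec payoff ::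
  "real ^ 'k::finite ^ 'k \<Rightarrow> ('k \<Rightarrow> 'k \<Rightarrow> real) \<Rightarrow> nat \<Rightarrow> 'k policy \<Rightarrow> 'k \<Rightarrow> real" where
  "payoff M u 0 \<xi> x = u x (\<xi> [])"
| "payoff M u (Suc n) \<xi> x =
    (\<Sum>y\<in>UNIV. M $ x $ y * payoff M u n (continuation \<xi> (\<xi> [], x = \<xi> [])) y)"


subsection \<open>Expected utilities as finite sums\<close>

text \<open>The vector argument is the law of the next state: consuming a state only replaces it by
  a row of \<open>M\<close>, which suits induction over arbitrary priors.\<close>

primrec path_weight :: "real ^ 'k::finite ^ 'k \<Rightarrow> real ^ 'k \<Rightarrow> 'k list \<Rightarrow> real" where
  "path_weight M q [] = 1"
| "path_weight M q (x # xs) = q $ x * path_weight M (M $ x) xs"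

lemma path_weight_prod:
  "path_weight M q (x # xs) =
    q $ x * (\<Prod>i<length xs. M $ ((x # xs) ! i) $ ((x # xs) ! Suc i))"
proof (induction xs arbitrary: q x)
  case Nil
  show ?case by simp
next
  case (Cons y ys)
  have "path_weight M q (x # y # ys) = q $ x * path_weight M (M $ x) (y # ys)"
    by simp
  also note Cons.IH
  finally show ?case
    by (simp add: prod.lessThan_Suc_shift del: prod.lessThan_Suc)
qed

lemma measure_chain_prefix:
  assumes "q \<in> prob_vectors" "stochastic_matrix M" "length xs = Suc n"
  shows "measure (chain_measure q M) {\<omega>. map \<omega> [0..<Suc n] = xs} = path_weight M q xs"
proof -
  from assms(3) obtain x ys where xs: "xs = x # ys" "length ys = n"
    by (cases xs) auto
  have "{\<omega>. map \<omega> [0..<Suc n] = xs} = {\<omega>. \<forall>j\<in>{1..Suc n}. state_at j \<omega> = xs ! (j - 1)}"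
  proof (intro Collect_cong iffI ballI)
    fix \<omega> j assume "map \<omega> [0..<Suc n] = xs" "j \<in> {1..Suc n}"
    then show "state_at j \<omega> = xs ! (j - 1)"
      by (auto simp: state_at_def simp del: upt_Suc)
  next
    fix \<omega> assume *: "\<forall>j\<in>{1..Suc n}. state_at j \<omega> = xs ! (j - 1)"
    show "map \<omega> [0..<Suc n] = xs"
    proof (rule nth_equalityI)
      fix i assume "i < length (map \<omega> [0..<Suc n])"
      with bspec[OF *, of "Suc i"] show "map \<omega> [0..<Suc n] ! i = xs ! i"
        by (simp add: state_at_def del: upt_Suc)
    qed (use assms(3) in simp)
  qed
  then have "measure (chain_measure q M) {\<omega>. map \<omega> [0..<Suc n] = xs} =
      q $ (xs ! 0) * (\<Prod>j=1..n. M $ (xs ! (j - 1)) $ (xs ! j))"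
    using chain_law[OF assms(1,2), of n "\<lambda>j. xs ! (j - 1)"] by simp
  also have "(\<Prod>j=1..n. M $ (xs ! (j - 1)) $ (xs ! j)) = (\<Prod>i<n. M $ (xs ! i) $ (xs ! Suc i))"
    by (rule prod.reindex_bij_witness[of _ Suc "\<lambda>j. j - 1"]) auto
  finally show ?thesis
    using path_weight_prod[of M q x ys] by (simp add: xs del: path_weight.simps upt_Suc)
qed

lemma history_prefix_cong:
  assumes "\<And>i. i < n \<Longrightarrow> \<omega> i = \<omega>' i"
  shows "history \<xi> \<omega> n = history \<xi> \<omega>' n"
  using assms by (induction n) (simp_all add: Let_def state_at_def)

text \<open>\<open>history\<close> appends new pairs at the end while \<open>payoff\<close> recurses
  from the front; peeling off the first stage reconciles the two.\<close>

lemma history_Suc_continuation: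
  "history \<xi> \<omega> (Suc n) =
    (\<xi> [], \<omega> 0 = \<xi> []) # history (continuation \<xi> (\<xi> [], \<omega> 0 = \<xi> [])) (\<lambda>i. \<omega> (Suc i)) n"
proof (induction n)
  case 0
  show ?case by (simp add: state_at_def Let_def)
next
  case (Suc n)
  have "history \<xi> \<omega> (Suc (Suc n)) =
      (let h = history \<xi> \<omega> (Suc n); a = \<xi> h in h @ [(a, state_at (Suc (Suc n)) \<omega> = a)])"
    by simp
  also note Suc.IH
  finally show ?case
    by (simp add: Let_def state_at_def continuation_def)
qed

lemma sum_lists_Suc:
  fixes f :: "'k::finite list \<Rightarrow> 'b::comm_monoid_add"
  shows "(\<Sum>xs | length xs = Suc n. f xs) = (\<Sum>x\<in>UNIV. \<Sum>xs | length xs = n. f (x # xs))"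
proof -
  have "(\<Sum>x\<in>UNIV. \<Sum>xs | length xs = n. f (x # xs)) =
      (\<Sum>(x, xs)\<in>UNIV \<times> {xs. length xs = n}. f (x # xs))"
    by (rule sum.cartesian_product)
  also have "\<dots> = (\<Sum>xs | length xs = Suc n. f xs)"
    by (rule sum.reindex_bij_witness[of _ "\<lambda>xs. (hd xs, tl xs)" "\<lambda>(x, xs). x # xs"])
      (auto simp: length_Suc_conv)
  finally show ?thesis ..
qed

text \<open>Splitting off the first state \<open>x\<close> turns the prior into \<open>M $ x\<close>
  and the policy into its continuation, so the induction keeps both arbitrary.\<close>

lemma sum_path_weight_payoff:
  fixes q :: "real ^ 'k::finite"
  shows "(\<Sum>xs | length xs = Suc n. path_weight M q xs * u (xs ! n) (\<xi> (history \<xi> ((!) xs) n))) =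
    (\<Sum>x\<in>UNIV. q $ x * payoff M u n \<xi> x)"
proof (induction n arbitrary: q \<xi>)
  case 0
  show ?case by (simp add: sum_lists_Suc)
next
  case (Suc n)
  have "(\<Sum>xs | length xs = Suc (Suc n).
        path_weight M q xs * u (xs ! Suc n) (\<xi> (history \<xi> ((!) xs) (Suc n)))) =
      (\<Sum>x\<in>UNIV. q $ x * (\<Sum>xs | length xs = Suc n. path_weight M (M $ x) xs *
        u (xs ! n) (continuation \<xi> (\<xi> [], x = \<xi> [])
          (history (continuation \<xi> (\<xi> [], x = \<xi> [])) ((!) xs) n))))"
    by (subst sum_lists_Suc)
      (simp add: history_Suc_continuation sum_distrib_left mult.assoc continuation_def
        del: history.simps)
  also have "\<dots> = (\<Sum>x\<in>UNIV. q $ x * payoff M u (Suc n) \<xi> x)"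
    by (simp only: Suc.IH payoff.simps)
  finally show ?case .
qed

text \<open>The utility at stage \<open>Suc n\<close> depends only on the first \<open>Suc n\<close>
  coordinates, so the integral collapses to a finite sum over the cylinder sets
  \<open>?E xs\<close>.\<close>

lemma expected_utility_eq:
  fixes q :: "real ^ 'k::finite"
  assumes "q \<in> prob_vectors" "stochastic_matrix M"
  shows "expected_utility M u (Suc n) q \<xi> = (\<Sum>x\<in>UNIV. q $ x * payoff M u n \<xi> x)"
proof -
  interpret prob_space "chain_measure q M"
    by (rule prob_space_chain_measure)
  let ?L = "{xs :: 'k list. length xs = Suc n}"
  let ?E = "\<lambda>xs. {\<omega>. map \<omega> [0..<Suc n] = xs}"
  let ?g = "\<lambda>xs :: 'k list. u (xs ! n) (\<xi> (history \<xi> ((!) xs) n))"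
  have fin: "finite ?L"
    using finite_lists_length_eq[of "UNIV :: 'k set" "Suc n"] by simp
  have meas: "?E xs \<in> events" if "length xs = Suc n" for xs
  proof -
    have "?E xs = (\<Inter>i\<in>{..n}. (\<lambda>\<omega>. \<omega> i) -` {xs ! i} \<inter> space (Pi\<^sub>M UNIV (\<lambda>_. count_space UNIV)))"
      using that by (auto simp: list_eq_iff_nth_eq space_PiM less_Suc_eq_le simp del: upt_Suc)
    also have "\<dots> \<in> sets (Pi\<^sub>M UNIV (\<lambda>_. count_space UNIV))"
      by (intro sets.finite_INT measurable_sets[OF measurable_component_singleton]) auto
    finally show ?thesis
      by (simp add: sets_chain_measure)
  qed
  have "u (state_at (Suc n) \<omega>) (act \<xi> (Suc n) \<omega>) = (\<Sum>xs\<in>?L. ?g xs * indicator (?E xs) \<omega>)" for \<omega>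
  proof -
    let ?xs = "map \<omega> [0..<Suc n]"
    have "history \<xi> \<omega> n = history \<xi> ((!) ?xs) n"
      by (rule history_prefix_cong) (simp del: upt_Suc)
    then have "u (state_at (Suc n) \<omega>) (act \<xi> (Suc n) \<omega>) = ?g ?xs"
      by (simp add: state_at_def act_def del: upt_Suc)
    also have "\<dots> = (\<Sum>xs\<in>?L. if xs = ?xs then ?g xs else 0)"
      using fin by (simp add: sum.delta del: upt_Suc)
    also have "\<dots> = (\<Sum>xs\<in>?L. ?g xs * indicator (?E xs) \<omega>)"
      by (intro sum.cong) (auto simp: indicator_def)
    finally show ?thesis .
  qed
  then have "expected_utility M u (Suc n) q \<xi> = (\<Sum>xs\<in>?L. ?g xs * measure (chain_measure q M) (?E xs))"
    unfolding expected_utility_def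
    using meas by (simp add: emeasure_eq_measure del: upt_Suc)
  also have "\<dots> = (\<Sum>xs\<in>?L. path_weight M q xs * ?g xs)"
    by (intro sum.cong) (auto simp: measure_chain_prefix[OF assms] simp del: upt_Suc)
  finally show ?thesis
    by (simp add: sum_path_weight_payoff)
qed

lemma expected_utility_le_stage_value: "expected_utility M u n q \<xi> \<le> stage_value M u n q"
  unfolding stage_value_def by (rule Max_ge[OF finite_range_expected_utility rangeI])

lemma stage_value_attained:
  obtains \<xi> where "expected_utility M u n q \<xi> = stage_value M u n q"
  using Max_in[OF finite_range_expected_utility[of M u n q]] unfolding stage_value_def by auto


subsection \<open>Revealing the initial state\<close>

text \<open>Knowledge of the initial state is encoded as a point-mass prior, so that the optimal
  policy may depend on \<open>x\<close>.\<close>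

definition informed_value ::
  "real ^ 'k::finite ^ 'k \<Rightarrow> ('k \<Rightarrow> 'k \<Rightarrow> real) \<Rightarrow> nat \<Rightarrow> 'k \<Rightarrow> real" where
  "informed_value M u n x = stage_value M u (Suc n) (axis x 1)"

context
  fixes M :: "real ^ 'k::finite ^ 'k" and u :: "'k \<Rightarrow> 'k \<Rightarrow> real"
  assumes M: "stochastic_matrix M" and u: "\<And>x a. u x a \<in> {0..1}"
begin

lemma row_prob: "M $ x \<in> prob_vectors"
  using M by (simp add: stochastic_matrix_def)

lemma row_nonneg: "0 \<le> M $ x $ y" and row_sum: "(\<Sum>y\<in>UNIV. M $ x $ y) = 1"
  using row_prob[of x] by (simp_all add: prob_vectors_def)

lemma payoff_bounds: "payoff M u n \<xi> x \<in> {0..1}"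
proof (induction n arbitrary: \<xi> x)
  case 0
  show ?case using u by simp
next
  case (Suc n)
  let ?c = "\<lambda>y. payoff M u n (continuation \<xi> (\<xi> [], x = \<xi> [])) y"
  have "(\<Sum>y\<in>UNIV. M $ x $ y * ?c y) \<le> (\<Sum>y\<in>UNIV. M $ x $ y)"
    using Suc by (intro sum_mono mult_left_le) (auto simp: row_nonneg)
  moreover have "0 \<le> (\<Sum>y\<in>UNIV. M $ x $ y * ?c y)"
    using Suc by (intro sum_nonneg mult_nonneg_nonneg) (auto simp: row_nonneg)
  ultimately show ?case by (simp add: row_sum)
qed

lemma axis_prob: "axis x 1 \<in> prob_vectors"
  by (simp add: prob_vectors_def axis_def)

lemma expected_utility_axis: "expected_utility M u (Suc n) (axis x 1) \<xi> = payoff M u n \<xi> x"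
  unfolding expected_utility_eq[OF axis_prob M]
  by (simp add: axis_def if_distrib[of "\<lambda>r. r * _"] cong: if_cong)

lemma payoff_le_informed_value: "payoff M u n \<xi> x \<le> informed_value M u n x"
  unfolding informed_value_def expected_utility_axis[symmetric]
  by (rule expected_utility_le_stage_value)

lemma informed_value_attained:
  obtains \<xi> where "payoff M u n \<xi> x = informed_value M u n x"
  using stage_value_attained unfolding informed_value_def expected_utility_axis[symmetric] .

lemma informed_value_le_one: "informed_value M u n x \<le> 1"
  by (rule informed_value_attained[of n x]) (use payoff_bounds in \<open>metis atLeastAtMost_iff\<close>)

text \<open>When \<open>x\<close> is known, the policy determines the first signal, so the first
  stage teaches nothing and a problem with prior \<open>M $ x\<close> remains.\<close>

lemma informed_value_Suc: "informed_value M u (Suc n) x \<le> stage_value M u (Suc n) (M $ x)"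
proof -
  obtain \<xi> where "payoff M u (Suc n) \<xi> x = informed_value M u (Suc n) x"
    by (rule informed_value_attained)
  then have "informed_value M u (Suc n) x =
      expected_utility M u (Suc n) (M $ x) (continuation \<xi> (\<xi> [], x = \<xi> []))"
    by (simp add: expected_utility_eq[OF row_prob M])
  then show ?thesis
    by (simp add: expected_utility_le_stage_value)
qed

text \<open>The left side uses one policy for all initial states, whereas the right side may choose
  one for each.\<close>

lemma stage_value_le_informed:
  assumes "q \<in> prob_vectors"
  shows "stage_value M u (Suc n) q \<le> (\<Sum>x\<in>UNIV. q $ x * informed_value M u n x)"
proof -
  obtain \<xi> where "expected_utility M u (Suc n) q \<xi> = stage_value M u (Suc n) q"
    by (rule stage_value_attained)
  then have "stage_value M u (Suc n) q = (\<Sum>x\<in>UNIV. q $ x * payoff M u n \<xi> x)"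
    by (simp add: expected_utility_eq[OF assms M])
  also have "\<dots> \<le> (\<Sum>x\<in>UNIV. q $ x * informed_value M u n x)"
    using assms
    by (intro sum_mono mult_left_mono payoff_le_informed_value) (auto simp: prob_vectors_def)
  finally show ?thesis .
qed

lemma stage_value_bounds:
  assumes q: "q \<in> prob_vectors"
  shows "stage_value M u (Suc n) q \<in> {0..1}"
proof -
  have "stage_value M u (Suc n) q \<le> (\<Sum>x\<in>UNIV. q $ x * informed_value M u n x)"
    by (rule stage_value_le_informed[OF q])
  also have "\<dots> \<le> (\<Sum>x\<in>UNIV. q $ x)"
    using q by (intro sum_mono mult_left_le informed_value_le_one) (auto simp: prob_vectors_def)
  finally have "stage_value M u (Suc n) q \<le> 1"
    using q by (simp add: prob_vectors_def)
  moreover have "0 \<le> expected_utility M u (Suc n) q (\<lambda>_. undefined)"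
    unfolding expected_utility_eq[OF q M]
    using q payoff_bounds by (intro sum_nonneg mult_nonneg_nonneg) (auto simp: prob_vectors_def)
  then have "0 \<le> stage_value M u (Suc n) q"
    using expected_utility_le_stage_value by (rule order_trans)
  ultimately show ?thesis by simp
qed

text \<open>
  The measure \<open>p\<close> need not be normalised: in the induction it is the joint law of the current state
  and the event that no guess has succeeded so far.
\<close>

lemma exists_policy_near_informed:
  fixes p :: "'k \<Rightarrow> real"
  assumes "\<And>x. 0 \<le> p x"
  shows "\<exists>\<xi>. (\<Sum>x\<in>UNIV. p x * informed_value M u n x) \<le>
    (\<Sum>x\<in>UNIV. p x * payoff M u n \<xi> x) + (1 - 1 / real CARD('k)) ^ n * (\<Sum>x\<in>UNIV. p x)"
  using assms
proof (induction n arbitrary: p)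
  case 0
  \<comment> \<open>Before any guess the loss is at most the whole mass; the zeroth power is 1 even
    when \<open>CARD('k)\<close> is 1.\<close>
  have "(\<Sum>x\<in>UNIV. p x * informed_value M u 0 x) \<le> (\<Sum>x\<in>UNIV. p x)"
    using 0 by (intro sum_mono mult_left_le informed_value_le_one) auto
  moreover have "0 \<le> (\<Sum>x\<in>UNIV. p x * payoff M u 0 (\<lambda>_. undefined) x)"
    using 0 u by (intro sum_nonneg mult_nonneg_nonneg) auto
  ultimately show ?case
    by (intro exI[of _ "\<lambda>_. undefined"]) simp
next
  case (Suc n)
  let ?c = "1 - 1 / real CARD('k)"
  have c: "0 \<le> ?c" by simp
  \<comment> \<open>The guess \<open>a\<close> is a state of largest mass, which carries at least
    the average mass per state.\<close>
  obtain a where a: "p x \<le> p a" for x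
  proof -
    have "Max (range p) \<in> range p" by (rule Max_in) auto
    then obtain a where "Max (range p) = p a" by (rule imageE)
    then have "p x \<le> p a" for x by (simp flip: \<open>Max (range p) = p a\<close>)
    then show ?thesis by (rule that)
  qed
  have "(\<Sum>x\<in>UNIV. p x) \<le> real CARD('k) * p a"
    using sum_bounded_above[of UNIV p "p a"] a by simp
  then have a_ge: "(\<Sum>x\<in>UNIV. p x) / real CARD('k) \<le> p a"
    by (simp add: field_simps)
  have split: "(\<Sum>x\<in>UNIV. f x) = f a + (\<Sum>x\<in>-{a}. f x)" for f :: "'k \<Rightarrow> real"
    by (simp add: sum.remove[of UNIV a] Compl_eq_Diff_UNIV)
  \<comment> \<open>The mass of the next state jointly with a failed guess of
    \<open>a\<close>.\<close>
  define p' where "p' y = (\<Sum>x\<in>-{a}. p x * M $ x $ y)" for y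
  have p'_nonneg: "0 \<le> p' y" for y
    unfolding p'_def using Suc.prems row_nonneg by (intro sum_nonneg) auto
  have sum_p': "(\<Sum>y\<in>UNIV. p' y * f y) = (\<Sum>x\<in>-{a}. p x * (\<Sum>y\<in>UNIV. M $ x $ y * f y))"
    for f
    unfolding p'_def sum_distrib_left sum_distrib_right mult.assoc by (rule sum.swap)
  obtain \<eta> where \<eta>: "(\<Sum>x\<in>UNIV. p' x * informed_value M u n x) \<le>
      (\<Sum>x\<in>UNIV. p' x * payoff M u n \<eta> x) + ?c ^ n * (\<Sum>x\<in>UNIV. p' x)"
    using Suc.IH[of p', OF p'_nonneg] by blast
  \<comment> \<open>After a success the state is \<open>a\<close>, and an optimal policy for the
    prior \<open>M $ a\<close> loses nothing against the informed player.\<close>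
  obtain \<zeta> where \<zeta>: "expected_utility M u (Suc n) (M $ a) \<zeta> = stage_value M u (Suc n) (M $ a)"
    by (rule stage_value_attained)
  define \<xi> where
    "\<xi> h = (case h of [] \<Rightarrow> a | (b, s) # h' \<Rightarrow> if s then \<zeta> h' else \<eta> h')" for h :: "('k \<times> bool) list"
  have payoff_\<xi>: "payoff M u (Suc n) \<xi> x = (\<Sum>y\<in>UNIV. M $ x $ y * payoff M u n (if x = a then \<zeta> else \<eta>) y)"
    for x
    by (simp add: continuation_def \<xi>_def)
  have "(\<Sum>x\<in>UNIV. p x * informed_value M u (Suc n) x) =
      p a * informed_value M u (Suc n) a + (\<Sum>x\<in>-{a}. p x * informed_value M u (Suc n) x)"
    by (rule split)
  \<comment> \<open>On success the bound stops at the value that \<open>\<zeta>\<close> attains; on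
    failure the next state is revealed as well, which brings in the induction hypothesis for
    \<open>p'\<close>.\<close>
  also have "\<dots> \<le> p a * stage_value M u (Suc n) (M $ a) +
      (\<Sum>x\<in>-{a}. p x * (\<Sum>y\<in>UNIV. M $ x $ y * informed_value M u n y))"
    using order_trans[OF informed_value_Suc stage_value_le_informed[OF row_prob]] Suc.prems
    by (intro add_mono sum_mono mult_left_mono informed_value_Suc) auto
  also have "\<dots> = p a * stage_value M u (Suc n) (M $ a) + (\<Sum>x\<in>UNIV. p' x * informed_value M u n x)"
    by (simp only: sum_p')
  also have "\<dots> \<le> p a * stage_value M u (Suc n) (M $ a) +
      ((\<Sum>x\<in>UNIV. p' x * payoff M u n \<eta> x) + ?c ^ n * (\<Sum>x\<in>UNIV. p' x))"
    using \<eta> by (rule add_left_mono)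
  also have "\<dots> = (\<Sum>x\<in>UNIV. p x * payoff M u (Suc n) \<xi> x) + ?c ^ n * (\<Sum>x\<in>UNIV. p' x)"
    unfolding payoff_\<xi> sum_p' \<zeta>[symmetric] expected_utility_eq[OF row_prob M] split[of "\<lambda>x. p x * _ x"]
    by simp
  also have "(\<Sum>x\<in>UNIV. p' x) = (\<Sum>x\<in>UNIV. p x) - p a"
    using sum_p'[of "\<lambda>_. 1"] split[of p] by (simp add: row_sum)
  \<comment> \<open>By the choice of \<open>a\<close>, at most the fraction \<open>?c\<close> of the
    mass survives a guess; this is the additional factor.\<close>
  also have "?c ^ n * \<dots> \<le> ?c ^ n * (?c * (\<Sum>x\<in>UNIV. p x))"
    using a_ge c by (intro mult_left_mono zero_le_power) (auto simp: left_diff_distrib)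
  finally show ?case
    by (intro exI[of _ \<xi>]) (simp add: mult.assoc mult.left_commute)
qed

end


subsection \<open>Stationary chains\<close>

text \<open>Exchanging the sums moves \<open>M\<close> onto the prior, where invariance absorbs
  it.\<close>

lemma sum_stationary:
  fixes \<pi> :: "real ^ 'k::finite"
  assumes "\<pi> v* M = \<pi>"
  shows "(\<Sum>x\<in>UNIV. \<pi> $ x * (\<Sum>y\<in>UNIV. M $ x $ y * f y)) = (\<Sum>y\<in>UNIV. \<pi> $ y * f y)"
proof -
  have row: "(\<Sum>x\<in>UNIV. \<pi> $ x * M $ x $ y) = \<pi> $ y" for y
    using arg_cong[OF assms, of "\<lambda>v. v $ y"]
    by (simp add: vector_matrix_mult_def mult.commute)
  have "(\<Sum>y\<in>UNIV. \<pi> $ y * f y) = (\<Sum>y\<in>UNIV. (\<Sum>x\<in>UNIV. \<pi> $ x * M $ x $ y) * f y)"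
    by (simp only: row)
  also have "\<dots> = (\<Sum>x\<in>UNIV. \<pi> $ x * (\<Sum>y\<in>UNIV. M $ x $ y * f y))"
    unfolding sum_distrib_left sum_distrib_right mult.assoc by (rule sum.swap)
  finally show ?thesis ..
qed

text \<open>Ignoring the first observation and starting the shorter optimal policy at the second
  stage loses nothing, because the second state again has law \<pi>.\<close>

lemma stage_value_stationary_Suc:
  assumes M: "stochastic_matrix M" and q: "\<pi> \<in> prob_vectors" and inv: "\<pi> v* M = \<pi>"
  shows "stage_value M u (Suc n) \<pi> \<le> stage_value M u (Suc (Suc n)) \<pi>"
proof -
  obtain \<xi> where \<xi>: "expected_utility M u (Suc n) \<pi> \<xi> = stage_value M u (Suc n) \<pi>"
    by (rule stage_value_attained)
  \<comment> \<open>\<open>tl\<close> erases the first pair, whatever action and signal it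
    records.\<close>
  have "continuation (\<lambda>h. \<xi> (tl h)) e = \<xi>" for e
    by (simp add: continuation_def)
  then have "expected_utility M u (Suc (Suc n)) \<pi> (\<lambda>h. \<xi> (tl h)) = stage_value M u (Suc n) \<pi>"
    by (simp add: expected_utility_eq[OF q M] sum_stationary[OF inv] flip: \<xi>)
  then show ?thesis
    by (metis expected_utility_le_stage_value)
qed

text \<open>With one more transition, revealing the second state instead of the first can only help;
  by invariance that state has law \<pi> too.\<close>

lemma informed_stationary_antimono:
  assumes M: "stochastic_matrix M" and u: "\<And>x a. u x a \<in> {0..1}"
    and q: "\<pi> \<in> prob_vectors" and inv: "\<pi> v* M = \<pi>"
  shows "decseq (\<lambda>n. \<Sum>x\<in>UNIV. \<pi> $ x * informed_value M u n x)"
proof (rule decseq_SucI)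
  fix n
  have "(\<Sum>x\<in>UNIV. \<pi> $ x * informed_value M u (Suc n) x) \<le>
      (\<Sum>x\<in>UNIV. \<pi> $ x * (\<Sum>y\<in>UNIV. M $ x $ y * informed_value M u n y))"
    using q order_trans[OF informed_value_Suc[OF M u] stage_value_le_informed[OF M u row_prob[OF M u]]]
    by (intro sum_mono mult_left_mono) (auto simp: prob_vectors_def)
  then show "(\<Sum>x\<in>UNIV. \<pi> $ x * informed_value M u (Suc n) x) \<le>
      (\<Sum>x\<in>UNIV. \<pi> $ x * informed_value M u n x)"
    by (simp add: sum_stationary[OF inv])
qed

text \<open>The informed average at \<open>n\<close> dominates all later values and is nearly
  attained by one policy. The error does not depend on \<open>m\<close>, which allows a limit in
  \<open>m\<close>.\<close>

lemma stage_value_stationary_gap: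
  fixes M :: "real ^ 'k::finite ^ 'k"
  assumes M: "stochastic_matrix M" and u: "\<And>x a. u x a \<in> {0..1}"
    and q: "\<pi> \<in> prob_vectors" and inv: "\<pi> v* M = \<pi>" and "n \<le> m"
  shows "stage_value M u (Suc m) \<pi> \<le> stage_value M u (Suc n) \<pi> + (1 - 1 / real CARD('k)) ^ n"
proof -
  have "stage_value M u (Suc m) \<pi> \<le> (\<Sum>x\<in>UNIV. \<pi> $ x * informed_value M u m x)"
    by (rule stage_value_le_informed[OF M u q])
  also have "\<dots> \<le> (\<Sum>x\<in>UNIV. \<pi> $ x * informed_value M u n x)"
    using decseqD[OF informed_stationary_antimono[OF M u q inv] \<open>n \<le> m\<close>] .
  also obtain \<xi> where "\<dots> \<le>
      (\<Sum>x\<in>UNIV. \<pi> $ x * payoff M u n \<xi> x) + (1 - 1 / real CARD('k)) ^ n * (\<Sum>x\<in>UNIV. \<pi> $ x)"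
    using exists_policy_near_informed[where u = u and p = "\<lambda>x. \<pi> $ x" and n = n, OF M u] q by (auto simp: prob_vectors_def)
  also have "(\<Sum>x\<in>UNIV. \<pi> $ x) = 1"
    using q by (simp add: prob_vectors_def)
  also have "(\<Sum>x\<in>UNIV. \<pi> $ x * payoff M u n \<xi> x) \<le> stage_value M u (Suc n) \<pi>"
    unfolding expected_utility_eq[OF q M, symmetric] by (rule expected_utility_le_stage_value)
  finally show ?thesis by simp
qed

theorem theorem1:
  fixes M :: "real ^ 'k::finite ^ 'k" and u :: "'k \<Rightarrow> 'k \<Rightarrow> real" and \<pi> :: "real ^ 'k"
  assumes "stochastic_matrix M"
    and "\<And>x a. u x a \<in> {0..1}"
    and "\<pi> \<in> prob_vectors"
    and "\<pi> v* M = \<pi>"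
  shows "mono_on {1..} (\<lambda>n. stage_value M u n \<pi>) \<and>
    (\<exists>vinf\<in>{0..1}. (\<lambda>n. stage_value M u n \<pi>) \<longlonglongrightarrow> vinf \<and>
      (\<forall>n\<ge>1. 0 \<le> vinf - stage_value M u n \<pi> \<and>
        vinf - stage_value M u n \<pi> \<le> (1 - 1 / real CARD('k)) ^ (n - 1)))"
proof -
  \<comment> \<open>Stages start at 1; after this shift the exponent of the error equals the
    index.\<close>
  let ?v = "\<lambda>n. stage_value M u (Suc n) \<pi>"
  have bounds: "?v n \<in> {0..1}" for n
    using assms by (intro stage_value_bounds) auto
  have inc: "incseq ?v"
    using assms by (intro incseq_SucI stage_value_stationary_Suc) auto
  then obtain w where w: "?v \<longlonglongrightarrow> w" "\<And>n. ?v n \<le> w"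
    using incseq_convergent[of ?v 1] bounds by auto
  have "w \<le> 1"
    using bounds by (intro LIMSEQ_le_const2[OF w(1)]) auto
  moreover have "0 \<le> w"
    using bounds[of 0] w(2)[of 0] by simp
  \<comment> \<open>Here \<open>n\<close> is fixed and the later stage of the gap bound tends to
    infinity.\<close>
  moreover have "w \<le> ?v n + (1 - 1 / real CARD('k)) ^ n" for n
    using assms by (intro LIMSEQ_le_const2[OF w(1)] exI[of _ n] allI impI stage_value_stationary_gap) auto
  then have "w - stage_value M u n \<pi> \<le> (1 - 1 / real CARD('k)) ^ (n - 1)" if "n \<ge> 1" for n
    using that by (cases n) (simp_all add: algebra_simps)
  moreover have "stage_value M u n \<pi> \<le> w" if "n \<ge> 1" for n
    using that w(2)[of "n - 1"] by simp
  moreover have "(\<lambda>n. stage_value M u n \<pi>) \<longlonglongrightarrow> w"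
    using w(1) by (rule LIMSEQ_imp_Suc)
  moreover have "mono_on {1..} (\<lambda>n. stage_value M u n \<pi>)"
  proof (rule mono_onI)
    fix m n :: nat assume "m \<in> {1..}" "m \<le> n"
    then show "stage_value M u m \<pi> \<le> stage_value M u n \<pi>"
      using incseqD[OF inc, of "m - 1" "n - 1"] by simp
  qed
  ultimately show ?thesis
    by (intro conjI bexI[of _ w]) auto
qed

end
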